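(* Let $K\ge 2$, let $f(X)$ be a polynomial with integer coefficients in one variable, and let $g(X_2,\dots,X_K)$ be a polynomial with integer coefficients such that for every prime $q$ there exists $t\in\mathbb{Z}_q$ with $$g(x_2,\dots,x_{i-1},t,x_{i+1},\dots,x_K)=0 \text{ in } \mathbb{Z}_q$$ for all $i\in\{2,3,\dots,K\}$ and all values $x_k\in\mathbb{Z}_q$, $k\in\{2,\dots,K\}\setminus\{i\}$. Let $h(X_1,\dots,X_K)=f(X_1)+g(X_2,\dots,X_K)$, and consider the symmetric $K$-user deterministic interference channel in which, for each prime $q$, receiver $i\in\{1,\dots,K\}$ observes $Y_i=h(X_i,X_{i+1},\dots,X_{i+K-1})\in\mathbb{Z}_q$ (indices taken cyclically modulo $K$ in $\{1,\dots,K\}$), so that $Y_1=f(X_1)+g(X_2,\dots,X_K)$. Then the total degrees of freedom of this channel satisfies $\mathrm{DoF}\ge\frac{K}{2}$.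
   Context: $\mathbb{Z}_q$ denotes the integers modulo a prime $q$. The polynomial $h$ is the same for all primes $q$ and is evaluated modulo $q$, giving a function $\mathbb{Z}_q^K\to\mathbb{Z}_q$. There are $K$ transmitter/receiver pairs (users); in each time slot transmitter $i$ sends $X_i\in\mathbb{Z}_q$, and receiver $i$ observes $Y_i$. The channel is memoryless (the same map is applied in each time slot). Codes and rates: for a block length $l\ge1$, user $i$ has a codebook $\mathcal{C}_i\subset\mathbb{Z}_q^l$; transmitter $i$ sends a codeword of $\mathcal{C}_i$ over $l$ time slots, and its rate is $R_i=\frac1l\log|\mathcal{C}_i|$. The rate tuple $(R_1,\dots,R_K)$ is achievable (for the given $q$) if there are such $l$ and codebooks for which each receiver $i$ can determine the codeword sent by transmitter $i$ from its $l$ received symbols, for every choice of codewords of all users. Total degrees of freedom: $$\mathrm{DoF}=\limsup_{q\to\infty,\ q\text{ prime}}\ \frac{\sup\{\sum_{i=1}^K R_i:(R_1,\dots,R_K)\text{ achievable}\}}{\log q}.$$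
   Formalization: The polynomial f is additionally assumed nonconstant; for constant f, Y_i does not depend on X_i, so every codebook has one codeword and DoF = 0 < K/2, making the claim false as stated. *)

theory Defs
  imports
    Complex_Main
    "HOL-Library.Poly_Mapping"
    "HOL-Library.Extended_Real"
    "HOL-Library.Liminf_Limsup"
    "HOL-Computational_Algebra.Primes"
    "HOL-Computational_Algebra.Polynomial"
begin

text \<open>
  Multivariate integer polynomials are finitely supported maps from monomials
  to coefficients; a monomial is a finitely supported map from variable
  indices to exponents, so that index \<open>k\<close> stands for the variable \<open>X\<^sub>k\<close>.
\<close>

type_synonym int_mpoly = "(nat \<Rightarrow>\<^sub>0 nat) \<Rightarrow>\<^sub>0 int"

definition mpoly_vars :: "int_mpoly \<Rightarrow> nat set" where
  "mpoly_vars p = (\<Union>m\<in>Poly_Mapping.keys p. Poly_Mapping.keys m)"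

definition mpoly_eval :: "int_mpoly \<Rightarrow> (nat \<Rightarrow> int) \<Rightarrow> int" where
  "mpoly_eval p x =
     (\<Sum>m\<in>Poly_Mapping.keys p. Poly_Mapping.lookup p m *
        (\<Prod>k\<in>Poly_Mapping.keys m. x k ^ Poly_Mapping.lookup m k))"

text \<open>The univariate polynomial \<open>f\<close>, read as the multivariate polynomial \<open>f(X\<^sub>v)\<close>.\<close>

definition mpoly_of_poly :: "nat \<Rightarrow> int poly \<Rightarrow> int_mpoly" where
  "mpoly_of_poly v f =
     (\<Sum>n\<le>degree f. Poly_Mapping.single (Poly_Mapping.single v n) (coeff f n))"

lemma mpoly_eval_superset:
  assumes "finite S" "Poly_Mapping.keys p \<subseteq> S"
  shows "mpoly_eval p x =
     (\<Sum>m\<in>S. Poly_Mapping.lookup p m *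
        (\<Prod>k\<in>Poly_Mapping.keys m. x k ^ Poly_Mapping.lookup m k))"
  unfolding mpoly_eval_def
  by (rule sum.mono_neutral_left) (use assms in \<open>auto simp: in_keys_iff\<close>)

lemma mpoly_eval_add: "mpoly_eval (p + r) x = mpoly_eval p x + mpoly_eval r x"
proof -
  let ?S = "Poly_Mapping.keys p \<union> Poly_Mapping.keys r"
  have "Poly_Mapping.keys (p + r) \<subseteq> ?S"
    by (rule Poly_Mapping.keys_add)
  then show ?thesis
    by (simp add: mpoly_eval_superset[where S = ?S] lookup_add
        distrib_right sum.distrib)
qed

lemma mpoly_eval_zero: "mpoly_eval 0 x = 0"
  by (simp add: mpoly_eval_def)

lemma mpoly_eval_sum: "mpoly_eval (\<Sum>i\<in>A. p i) x = (\<Sum>i\<in>A. mpoly_eval (p i) x)"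
  by (induction A rule: infinite_finite_induct)
     (simp_all add: mpoly_eval_zero mpoly_eval_add)

lemma mpoly_eval_mpoly_of_poly: "mpoly_eval (mpoly_of_poly v f) x = poly f (x v)"
proof -
  have "mpoly_eval (Poly_Mapping.single (Poly_Mapping.single v n) c) x = c * x v ^ n"
    for n and c :: int
    by (cases "n = 0") (simp_all add: mpoly_eval_def)
  then show ?thesis
    by (simp add: mpoly_of_poly_def mpoly_eval_sum poly_altdef)
qed

text \<open>Elements of \<open>\<int>\<^sub>q\<close> are represented by their residues in \<open>{0..<q}\<close>.\<close>

definition Zq :: "nat \<Rightarrow> int set" where
  "Zq q = {0..<int q}"

text \<open>
  Users are numbered \<open>1, \<dots>, K\<close>. Receiver \<open>i\<close> substitutes \<open>X\<^bsub>i+k-1\<^esub>\<close> for the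
  \<open>k\<close>-th argument of \<open>h\<close>; for \<open>i, k \<ge> 1\<close>, reducing the index \<open>i+k-1\<close> cyclically
  into \<open>{1..K}\<close> gives \<open>(i + k - 2) mod K + 1\<close>, without truncation in the subtraction.
\<close>

definition channel_output :: "nat \<Rightarrow> int_mpoly \<Rightarrow> nat \<Rightarrow> nat \<Rightarrow> (nat \<Rightarrow> int) \<Rightarrow> int" where
  "channel_output K h q i X = mpoly_eval h (\<lambda>k. X ((i + k - 2) mod K + 1)) mod int q"

definition received :: "nat \<Rightarrow> int_mpoly \<Rightarrow> nat \<Rightarrow> nat \<Rightarrow> nat \<Rightarrow> (nat \<Rightarrow> int list) \<Rightarrow> int list" where
  "received K h q l i w = map (\<lambda>s. channel_output K h q i (\<lambda>j. w j ! s)) [0..<l]"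

text \<open>
  Codebooks are required to be nonempty, as otherwise decodability would hold
  vacuously and \<open>ln 0 = 0\<close> would be taken for a rate.
\<close>

definition achievable :: "nat \<Rightarrow> int_mpoly \<Rightarrow> nat \<Rightarrow> (nat \<Rightarrow> real) \<Rightarrow> bool" where
  "achievable K h q R \<longleftrightarrow>
     (\<exists>l\<ge>1. \<exists>C :: nat \<Rightarrow> int list set.
        (\<forall>i\<in>{1..K}. C i \<noteq> {} \<and> C i \<subseteq> {c. length c = l \<and> set c \<subseteq> Zq q} \<and>
                     R i = ln (real (card (C i))) / real l) \<and>
        (\<forall>i\<in>{1..K}. \<exists>dec :: int list \<Rightarrow> int list.
           \<forall>w. (\<forall>j\<in>{1..K}. w j \<in> C j) \<longrightarrow> dec (received K h q l i w) = w i))"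

definition DoF :: "nat \<Rightarrow> int_mpoly \<Rightarrow> ereal" where
  "DoF K h =
     Limsup (inf at_top (principal {q :: nat. prime q}))
       (\<lambda>q. (SUP R\<in>{R. achievable K h q R}. ereal (\<Sum>i=1..K. R i)) / ereal (ln (real q)))"

end

theory Submission
  imports Defs "HOL-Real_Asymp.Real_Asymp"
begin

text \<open>
  If user \<open>1\<close> constantly sends the annihilating value \<open>t\<close>, then every other receiver sees the
  interference term \<open>g\<close> vanish and observes \<open>f(X\<^sub>i)\<close> alone. For large \<open>q\<close> the polynomial \<open>f\<close>
  takes at least \<open>q / degree f\<close> values on \<open>\<int>\<^sub>q\<close>, so the users \<open>2, \<dots>, K\<close> each get rate
  \<open>ln q - ln (degree f)\<close> with block length one. This even gives \<open>K - 1 \<ge> K / 2\<close> degrees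
  of freedom.
\<close>

text \<open>Induction on the degree: a root \<open>a\<close> mod \<open>q\<close> is split off by
  synthetic division, and primality of \<open>q\<close> forces every other root to be a root of the
  quotient. The condition on \<open>lead_coeff\<close> says that the degree survives reduction mod
  \<open>q\<close>; it passes to the quotient, which has the same leading coefficient.\<close>

lemma card_roots_mod_prime_le:
  fixes p :: "int poly" and q :: nat
  assumes "prime q" "\<not> int q dvd lead_coeff p"
  shows "card {x\<in>Zq q. int q dvd poly p x} \<le> degree p"
  using assms(2)
proof (induction "degree p" arbitrary: p)
  case 0
  then obtain c where "p = [:c:]"
    by (metis degree_eq_zeroE)
  with 0 show ?case by simp
next
  case (Suc n)
  show ?case
  proof (cases "\<exists>a\<in>Zq q. int q dvd poly p a")
    case True
    then obtain a where a: "a \<in> Zq q" "int q dvd poly p a" by blast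
    define s where "s = synthetic_div p a"
    \<comment> \<open>The division takes place over the integers, so the remainder
      \<open>poly p a\<close> need not vanish; it is only divisible by \<open>q\<close>.\<close>
    have p: "p = [:- a, 1:] * s + [:poly p a:]"
      using synthetic_div_correct'[of a p] by (simp add: s_def)
    have deg: "degree s = n"
      using Suc.hyps(2) by (simp add: s_def degree_synthetic_div)
    have "lead_coeff p = coeff ([:- a, 1:] * s + [:poly p a:]) (Suc n)"
      using Suc.hyps(2) p by metis
    also have "\<dots> = lead_coeff s"
      by (simp add: deg coeff_eq_0)
    finally have "card {x\<in>Zq q. int q dvd poly s x} \<le> n"
      using Suc.hyps(1)[of s] Suc.prems deg by simp
    moreover have "{x\<in>Zq q. int q dvd poly p x} \<subseteq> insert a {x\<in>Zq q. int q dvd poly s x}"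
    proof safe
      fix x assume x: "x \<in> Zq q" "int q dvd poly p x" "x \<noteq> a"
      have "poly p x = (x - a) * poly s x + poly p a"
        by (subst p) (simp add: algebra_simps)
      with x a have "int q dvd (x - a) * poly s x"
        by (metis dvd_add_left_iff)
      \<comment> \<open>Two distinct residues in \<open>{0..<q}\<close> differ by less than
        \<open>q\<close>.\<close>
      moreover have "\<not> int q dvd x - a"
        using x a zdvd_imp_le[of "int q" "\<bar>x - a\<bar>"] by (auto simp: Zq_def)
      ultimately show "int q dvd poly s x"
        using assms(1) prime_dvd_mult_iff[of "int q"] by simp
    qed
    moreover have "finite {x\<in>Zq q. int q dvd poly s x}"
      by (rule finite_subset[of _ "Zq q"]) (auto simp: Zq_def)
    ultimately have "card {x\<in>Zq q. int q dvd poly p x} \<le> Suc n"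
      by (smt (verit, best) card_insert_if card_mono finite_insert le_SucI le_trans not_less_eq_eq)
    then show ?thesis using Suc.hyps(2) by simp
  next
    case False
    then have "{x\<in>Zq q. int q dvd poly p x} = {}" by blast
    then show ?thesis by (simp only: card.empty)
  qed
qed

text \<open>\<open>A\<close> picks one preimage for each value of \<open>f\<close> mod
  \<open>q\<close>. The fibre over \<open>y\<close> is the root set of \<open>f - y\<close>, so it
  has at most \<open>degree f\<close> elements, and the fibres partition the \<open>q\<close>
  residues.\<close>

lemma poly_values_mod_prime:
  fixes f :: "int poly" and q :: nat
  assumes "prime q" "degree f > 0" "\<not> int q dvd lead_coeff f"
  obtains A where "A \<subseteq> Zq q" "inj_on (\<lambda>x. poly f x mod int q) A" "q \<le> degree f * card A"
proof -
  let ?F = "\<lambda>x. poly f x mod int q"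
  obtain A where A: "A \<subseteq> Zq q" "inj_on ?F A" "?F ` Zq q = ?F ` A"
    using subset_image_inj[of "?F ` Zq q" ?F "Zq q"] by blast
  have fin: "finite (Zq q)" by (simp add: Zq_def)
  have fibre: "card {x\<in>Zq q. ?F x = y} \<le> degree f" if "y \<in> ?F ` Zq q" for y
  proof -
    have y: "y mod int q = y" using that by auto
    \<comment> \<open>As \<open>f\<close> is not constant, subtracting \<open>y\<close> changes
      neither its degree nor its leading coefficient.\<close>
    have deg: "degree (f - [:y:]) = degree f"
      using assms(2) degree_add_eq_left[of "- [:y:]" f] by (simp only: diff_conv_add_uminus) simp
    moreover have "lead_coeff (f - [:y:]) = lead_coeff f"
      using assms(2) by (simp add: deg coeff_eq_0)
    moreover have "{x\<in>Zq q. ?F x = y} = {x\<in>Zq q. int q dvd poly (f - [:y:]) x}"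
      using y by (auto simp: mod_eq_dvd_iff[symmetric])
    ultimately show ?thesis
      using card_roots_mod_prime_le[OF assms(1), of "f - [:y:]"] assms(3) by simp
  qed
  have "Zq q = (\<Union>y\<in>?F ` Zq q. {x\<in>Zq q. ?F x = y})" by blast
  then have "q = card (\<Union>y\<in>?F ` Zq q. {x\<in>Zq q. ?F x = y})"
    by (metis (no_types, lifting) Zq_def card_atLeastLessThan_int diff_zero nat_int)
  also have "\<dots> \<le> (\<Sum>y\<in>?F ` Zq q. card {x\<in>Zq q. ?F x = y})"
    using fin by (intro card_UN_le) simp
  also have "\<dots> \<le> (\<Sum>y\<in>?F ` Zq q. degree f)"
    using fibre by (rule sum_mono)
  also have "\<dots> = degree f * card A"
    using A by (simp add: card_image)
  finally show ?thesis using that A by blast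
qed

text \<open>With block length one, user 1 always sends \<open>t\<close> and the others send symbols
  from \<open>A\<close>. Injectivity on \<open>A\<close> lets a receiver invert \<open>f\<close>
  once the interference is gone.\<close>

lemma achievable_silent_user:
  fixes K q :: nat and f :: "int poly" and g :: int_mpoly
  assumes "t \<in> Zq q"
    and g: "\<And>i x. i \<in> {2..K} \<Longrightarrow> (\<And>k. k \<in> {2..K} - {i} \<Longrightarrow> x k \<in> Zq q) \<Longrightarrow>
              mpoly_eval g (x(i := t)) mod int q = 0"
    and A: "A \<subseteq> Zq q" "A \<noteq> {}" "inj_on (\<lambda>x. poly f x mod int q) A"
  shows "achievable K (mpoly_of_poly 1 f + g) q (\<lambda>i. if i = 1 then 0 else ln (card A))"
proof -
  let ?h = "mpoly_of_poly 1 f + g"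
  define C where "C i = (if i = 1 then {[t]} else (\<lambda>x. [x]) ` A)" for i :: nat
  have card: "card ((\<lambda>x. [x]) ` A) = card A"
    by (rule card_image) (simp add: inj_on_def)
  have "\<exists>dec. \<forall>w. (\<forall>j\<in>{1..K}. w j \<in> C j) \<longrightarrow> dec (received K ?h q 1 i w) = w i"
    if i: "i \<in> {1..K}" for i
  proof (cases "i = 1")
    case True
    \<comment> \<open>The codebook of user 1 is a singleton, so a constant decoder suffices,
      whatever the interference.\<close>
    then show ?thesis
      using i by (intro exI[of _ "\<lambda>_. [t]"]) (force simp: C_def)
  next
    case False
    have "[the_inv_into A (\<lambda>x. poly f x mod int q) (hd (received K ?h q 1 i w))] = w i"
      if w: "\<forall>j\<in>{1..K}. w j \<in> C j" for w
    proof -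
      \<comment> \<open>These are the arguments of \<open>h\<close> in the order in which receiver
        \<open>i\<close> substitutes them.\<close>
      define x where "x k = w ((i + k - 2) mod K + 1) ! 0" for k
      have "w i \<in> C i" using w i by blast
      then obtain a where a: "a \<in> A" "w i = [a]"
        using False by (auto simp: C_def)
      have "x 1 = a"
      proof -
        have "(i + 1 - 2) mod K + 1 = i" using i False by auto
        then show ?thesis using a by (simp only: x_def) simp
      qed
      have "x k \<in> Zq q" for k
      proof -
        have "(i + k - 2) mod K + 1 \<in> {1..K}" using i by (simp add: Suc_leI)
        then have "w ((i + k - 2) mod K + 1) \<in> C ((i + k - 2) mod K + 1)" using w by blast
        then show ?thesis
          using A(1) assms(1) by (auto simp: x_def C_def split: if_splits)
      qed
      \<comment> \<open>The slot in which receiver \<open>i\<close> sees user 1: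
        \<open>i + m - 2 = K\<close> reduces to index 1. Since \<open>i\<close> lies in
        \<open>{2..K}\<close>, so does \<open>m\<close>, hence \<open>t\<close> enters through
        \<open>g\<close> and not through \<open>f\<close>.\<close>
      moreover define m where "m = K + 2 - i"
      moreover have "m \<in> {2..K}" using i False by (auto simp: m_def)
      moreover have "x m = t"
      proof -
        have "w 1 \<in> C 1" using w i by simp
        moreover have "i + m - 2 = K" using i by (simp add: m_def)
        ultimately show ?thesis by (simp add: x_def C_def)
      qed
      then have "x(m := t) = x" by auto
      ultimately have "mpoly_eval g x mod int q = 0"
        using g[of m x] by simp
      then have "channel_output K ?h q i (\<lambda>j. w j ! 0) = poly f a mod int q"
        using \<open>x 1 = a\<close> unfolding channel_output_def x_def[symmetric]
        by (metis add.right_neutral mod_add_right_eq mpoly_eval_add mpoly_eval_mpoly_of_poly)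
      then show ?thesis
        using a the_inv_into_f_f[OF A(3) a(1)] by (simp add: received_def)
    qed
    then show ?thesis
      by (intro exI[of _ "\<lambda>y. [the_inv_into A (\<lambda>x. poly f x mod int q) (hd y)]"]) blast
  qed
  moreover have "C i \<noteq> {} \<and> C i \<subseteq> {c. length c = 1 \<and> set c \<subseteq> Zq q}" for i
    using A assms(1) by (auto simp: C_def)
  moreover have "(if i = 1 then 0 else ln (card A)) = ln (real (card (C i))) / real 1" for i
    by (simp add: C_def card)
  ultimately show ?thesis
    unfolding achievable_def by (intro exI[of _ 1] conjI exI[of _ C]) auto
qed

text \<open>This is the infinitude of primes. On the trivial filter \<open>Limsup\<close> would be
  minus infinity, and a limit would not determine it.\<close>

lemma at_top_inf_primes_nontrivial: "inf at_top (principal {q :: nat. prime q}) \<noteq> bot"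
proof
  assume "inf at_top (principal {q :: nat. prime q}) = bot"
  then have "eventually (\<lambda>q :: nat. \<not> prime q) at_top"
    using eventually_inf_principal[of "\<lambda>_. False" at_top "{q :: nat. prime q}"] by simp
  then obtain N where "\<And>q :: nat. q \<ge> N \<Longrightarrow> \<not> prime q"
    by (auto simp: eventually_at_top_linorder)
  with bigger_prime[of N] show False by (meson less_imp_le)
qed

theorem theorem3:
  fixes K :: nat and f :: "int poly" and g :: int_mpoly
  assumes "K \<ge> 2"
    and "degree f > 0"
    and "mpoly_vars g \<subseteq> {2..K}"
    and "\<And>q :: nat. prime q \<Longrightarrow>
           \<exists>t\<in>Zq q. \<forall>i\<in>{2..K}. \<forall>x :: nat \<Rightarrow> int.
             (\<forall>k\<in>{2..K} - {i}. x k \<in> Zq q) \<longrightarrow> mpoly_eval g (x(i := t)) mod int q = 0"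
  shows "DoF K (mpoly_of_poly 1 f + g) \<ge> ereal (real K / 2)"
proof -
  let ?h = "mpoly_of_poly 1 f + g"
  let ?P = "inf at_top (principal {q :: nat. prime q})"
  let ?S = "\<lambda>q. SUP R\<in>{R. achievable K ?h q R}. ereal (\<Sum>i=1..K. R i)"
  \<comment> \<open>Normalised sum rate of the \<open>K - 1\<close> active users, with
    \<open>card A\<close> replaced by its lower bound \<open>q / degree f\<close>.\<close>
  define b where "b q = real (K - 1) * (ln (real q) - ln (degree f)) / ln (real q)" for q :: nat
  have lower: "ereal (b q) \<le> ?S q / ereal (ln (real q))"
    if q: "prime q" "int q > \<bar>lead_coeff f\<bar>" for q
  proof -
    have "lead_coeff f \<noteq> 0" using assms(2) by auto
    then have "\<not> int q dvd lead_coeff f"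
      using q(2) dvd_imp_le_int[of "lead_coeff f" "int q"] by linarith
    then obtain A where A: "A \<subseteq> Zq q" "inj_on (\<lambda>x. poly f x mod int q) A"
        "q \<le> degree f * card A"
      using poly_values_mod_prime q(1) assms(2) by blast
    have "q > 1" using q(1) by (rule prime_gt_1_nat)
    then have pos: "card A > 0" using A(3) by (cases "card A") auto
    then have "A \<noteq> {}" by auto
    let ?R = "\<lambda>i :: nat. if i = 1 then 0 else ln (card A)"
    obtain t where "t \<in> Zq q" and "\<forall>i\<in>{2..K}. \<forall>x :: nat \<Rightarrow> int.
        (\<forall>k\<in>{2..K} - {i}. x k \<in> Zq q) \<longrightarrow> mpoly_eval g (x(i := t)) mod int q = 0"
      using assms(4)[OF q(1)] by blast
    then have "achievable K ?h q ?R"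
      using A \<open>A \<noteq> {}\<close> by (intro achievable_silent_user) auto
    then have "ereal (\<Sum>i=1..K. ?R i) \<le> ?S q"
      by (intro SUP_upper) simp
    moreover have "(\<Sum>i=1..K. ?R i) = real (K - 1) * ln (card A)"
    proof -
      have "(\<Sum>i=1..K. ?R i) = (\<Sum>i\<in>{1..K} - {1}. ?R i)"
        by (rule sum.mono_neutral_right) auto
      also have "\<dots> = (\<Sum>i\<in>{1..K} - {1}. ln (card A))"
        by (rule sum.cong) auto
      finally show ?thesis using assms(1) by simp
    qed
    moreover have "ln (real q) - ln (degree f) \<le> ln (card A)"
    proof -
      have "ln (real q) \<le> ln (real (degree f * card A))"
        using A(3) \<open>q > 1\<close> pos assms(2) by (subst ln_le_cancel_iff) (simp_all del: of_nat_mult)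
      then show ?thesis using pos assms(2) by (simp add: ln_mult)
    qed
    then have "real (K - 1) * (ln (real q) - ln (degree f)) \<le> real (K - 1) * ln (card A)"
      by (rule mult_left_mono) simp
    ultimately have "ereal (real (K - 1) * (ln (real q) - ln (degree f))) \<le> ?S q"
      by (metis (no_types, lifting) ereal_less_eq(3) order_trans)
    then have "ereal (real (K - 1) * (ln (real q) - ln (degree f))) / ereal (ln (real q))
        \<le> ?S q / ereal (ln (real q))"
      using \<open>q > 1\<close> by (intro ereal_divide_right_mono) auto
    then show ?thesis using \<open>q > 1\<close> by (simp add: b_def)
  qed
  have "eventually (\<lambda>q :: nat. int q > \<bar>lead_coeff f\<bar>) at_top"
    by (rule eventually_at_top_linorderI[of "nat \<bar>lead_coeff f\<bar> + 1"]) linarith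
  then have "eventually (\<lambda>q. ereal (b q) \<le> ?S q / ereal (ln (real q))) ?P"
    unfolding eventually_inf_principal by (rule eventually_mono) (use lower in blast)
  then have "Limsup ?P (\<lambda>q. ereal (b q)) \<le> DoF K ?h"
    unfolding DoF_def by (rule Limsup_mono)
  moreover have "b \<longlonglongrightarrow> real (K - 1)"
    unfolding b_def by real_asymp
  \<comment> \<open>The limit over all naturals restricts to the finer filter of large
    primes.\<close>
  then have "((\<lambda>q. ereal (b q)) \<longlongrightarrow> ereal (real (K - 1))) ?P"
    by (intro tendsto_ereal) (rule tendsto_mono[OF inf_le1])
  then have "Limsup ?P (\<lambda>q. ereal (b q)) = ereal (real (K - 1))"
    using at_top_inf_primes_nontrivial by (intro lim_imp_Limsup)
  \<comment> \<open>Here \<open>K \<ge> 2\<close> enters.\<close>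
  moreover have "real K / 2 \<le> real (K - 1)"
    using assms(1) by simp
  ultimately show ?thesis
    by (metis ereal_less_eq(3) order_trans)
qed

end
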